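(* Let $\widehat{\mathcal S}$ be a subgroup of $\widehat{\mathcal M}=PGL(2,\mathbb Z)$ not contained in $\mathcal M=PSL(2,\mathbb Z)$, and let $\mathcal S=\widehat{\mathcal S}\cap\mathcal M$. Then the coset graph $\Gamma(\widehat{\mathcal S})$ (without $V$-edges) and the coset graph $\Gamma_{\mathcal M}(\mathcal S)$ of $\mathcal S$ in $\mathcal M$ are isomorphic (as graphs with labeled $A$-edges and labeled directed $B$-edges).
   Context: In $\widehat{\mathcal M}=PGL(2,\mathbb Z)$ put $A=\pm\begin{pmatrix}0&-1\\1&0\end{pmatrix}$, $B=\pm\begin{pmatrix}0&-1\\1&1\end{pmatrix}$, $V=\pm\begin{pmatrix}-1&0\\0&1\end{pmatrix}$. $A$ and $B$ generate the index $2$ subgroup $\mathcal M=PSL(2,\mathbb Z)$, and $A,B,V$ generate $\widehat{\mathcal M}$. $\Gamma(\widehat{\mathcal S})$ is the graph whose vertices are the right cosets $\widehat{\mathcal S}g$, $g\in\widehat{\mathcal M}$, with, for each vertex $v$, an undirected $A$-edge joining $v$ and $vA$ and a directed $B$-edge from $v$ to $vB$ (loops allowed); it is the Schreier coset graph of $\widehat{\mathcal S}$ in $\widehat{\mathcal M}$ with respect to $A,B,V$ with the $V$-edges deleted. $\Gamma_{\mathcal M}(\mathcal S)$ is the Schreier coset graph of $\mathcal S$ in $\mathcal M$ with respect to $A,B$: its vertices are the right cosets $\mathcal Sg$, $g\in\mathcal M$, with $A$-edges and $B$-edges defined in the same way. *)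

theory Defs
  imports "HOL-Analysis.Analysis" "HOL-Algebra.Coset"
begin

definition GL2Z :: "(int^2^2) monoid" where
  "GL2Z = \<lparr>carrier = {M. invertible M}, mult = (\<lambda>M N. M ** N), one = mat 1\<rparr>"

definition pm_id :: "(int^2^2) set" where
  "pm_id = {mat 1, - mat 1}"

definition PGL2Z :: "(int^2^2) set monoid" where
  "PGL2Z = GL2Z Mod pm_id"

text \<open>For \<open>M\<close> in \<open>GL(2,\<int>)\<close> the coset \<open>pm M\<close> is \<open>{M, -M}\<close>.\<close>

definition pm :: "int^2^2 \<Rightarrow> (int^2^2) set" where
  "pm M = pm_id #>\<^bsub>GL2Z\<^esub> M"

text \<open>\<open>PSL(2,\<int>)\<close> as a subset of \<open>PGL(2,\<int>)\<close>, and as a group in its own right.\<close>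

definition PSL2Z_set :: "(int^2^2) set set" where
  "PSL2Z_set = pm ` {M \<in> carrier GL2Z. det M = 1}"

definition PSL2Z :: "(int^2^2) set monoid" where
  "PSL2Z = PGL2Z\<lparr>carrier := PSL2Z_set\<rparr>"

definition gen_A :: "(int^2^2) set" where
  "gen_A = pm (vector [vector [0, -1], vector [1, 0]])"

definition gen_B :: "(int^2^2) set" where
  "gen_B = pm (vector [vector [0, -1], vector [1, 1]])"

text \<open>
  An undirected \<open>A\<close>-edge is its set of endpoints (a singleton for a loop), a directed
  \<open>B\<close>-edge is the pair of its source and its target. Sets of edges lose no multiplicities
  in a coset graph: every vertex is the source of exactly one \<open>B\<close>-edge, and since \<open>A\<close> is an
  involution, the \<open>A\<close>-edges at \<open>v\<close> and at \<open>vA\<close> are the same edge.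
\<close>

record 'v AB_graph =
  verts :: "'v set"
  A_edges :: "'v set set"
  B_edges :: "('v \<times> 'v) set"

definition AB_isomorphic :: "'v AB_graph \<Rightarrow> 'w AB_graph \<Rightarrow> bool" where
  "AB_isomorphic X Y \<longleftrightarrow>
    (\<exists>f. bij_betw f (verts X) (verts Y) \<and>
      (\<forall>u\<in>verts X. \<forall>v\<in>verts X. {u, v} \<in> A_edges X \<longleftrightarrow> {f u, f v} \<in> A_edges Y) \<and>
      (\<forall>u\<in>verts X. \<forall>v\<in>verts X. (u, v) \<in> B_edges X \<longleftrightarrow> (f u, f v) \<in> B_edges Y))"

definition coset_graph :: "('a, 'b) monoid_scheme \<Rightarrow> 'a set \<Rightarrow> 'a \<Rightarrow> 'a \<Rightarrow> 'a set AB_graph" where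
  "coset_graph G H a b =
    \<lparr>verts = rcosets\<^bsub>G\<^esub> H,
     A_edges = {{v, v #>\<^bsub>G\<^esub> a} | v. v \<in> rcosets\<^bsub>G\<^esub> H},
     B_edges = {(v, v #>\<^bsub>G\<^esub> b) | v. v \<in> rcosets\<^bsub>G\<^esub> H}\<rparr>"

end

theory Submission
  imports Defs
begin

text \<open>
  Since \<open>PSL(2,\<int>)\<close> has index 2 and \<open>S_hat\<close> is not contained in it, every right coset of \<open>S_hat\<close>
  meets \<open>PSL(2,\<int>)\<close>, and it does so in a single right coset of \<open>S_hat \<inter> PSL(2,\<int>)\<close>. Intersecting with \<open>PSL(2,\<int>)\<close>
  thus gives a bijection of vertices, and it commutes with right multiplication by \<open>A\<close> and \<open>B\<close>.
\<close>

lemma AB_isomorphic_coset_graph_Int: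
  fixes G (structure)
  assumes "group G" and H: "subgroup H G" and N: "subgroup N G"
    and HN: "H <#> N = carrier G" and a: "a \<in> N" and b: "b \<in> N"
  shows "AB_isomorphic (coset_graph G H a b) (coset_graph (G\<lparr>carrier := N\<rparr>) (H \<inter> N) a b)"
proof -
  interpret group G by fact
  interpret H: subgroup H G by fact
  interpret N: subgroup N G by fact
  let ?f = "\<lambda>v. v \<inter> N"
  have sub: "H \<inter> N \<subseteq> carrier G" by auto
  \<comment> \<open>Restricting the carrier leaves the multiplication alone, so cosets in the
    subgroup \<open>N\<close> are literally the same sets as in \<open>G\<close>.\<close>
  have rcos_eq: "H #>\<^bsub>G\<lparr>carrier := N\<rparr>\<^esub> x = H #> x" for H x
    by (simp add: r_coset_def)
  \<comment> \<open>Writing \<open>g\<close> as \<open>h\<close> times \<open>n\<close> with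
    \<open>HN\<close>, the factor \<open>h\<close> is absorbed by \<open>H\<close>, so every coset
    has a representative in \<open>N\<close>.\<close>
  have cosets: "rcosets H = {H #> n | n. n \<in> N}"
  proof -
    have "\<exists>n\<in>N. H #> g = H #> n" if g: "g \<in> carrier G" for g
    proof -
      obtain h n where hn: "h \<in> H" "n \<in> N" "g = h \<otimes> n"
        using g unfolding HN[symmetric] set_mult_def by blast
      have "H #> g = (H #> h) #> n"
        using hn by (simp add: coset_mult_assoc H.subset)
      also have "H #> h = H" using hn by (simp add: H.rcos_const[OF is_group])
      finally show ?thesis using hn by blast
    qed
    then show ?thesis using N.subset unfolding RCOSETS_def by blast
  qed
  \<comment> \<open>If \<open>n\<close> and \<open>h \<otimes> n\<close> both lie in
    \<open>N\<close>, so does \<open>h\<close>: cancel \<open>n\<close> on the right.\<close>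
  have Int_coset: "?f (H #> n) = (H \<inter> N) #> n" if n: "n \<in> N" for n
  proof -
    have "h \<in> N" if "h \<in> H" "h \<otimes> n \<in> N" for h
    proof -
      have "h = (h \<otimes> n) \<otimes> inv n" using that n by (simp add: m_assoc)
      then show ?thesis using that n by (metis N.m_closed N.m_inv_closed)
    qed
    then show ?thesis using n by (auto simp: r_coset_def)
  qed
  have cosets': "rcosets\<^bsub>G\<lparr>carrier := N\<rparr>\<^esub> (H \<inter> N) = ?f ` (rcosets H)"
    unfolding cosets unfolding RCOSETS_def
    by (simp add: rcos_eq setcompr_eq_image image_image Int_coset UNION_singleton_eq_range)
  have f_mult: "?f (v #> x) = ?f v #> x" if v: "v \<in> rcosets H" and x: "x \<in> N" for v x
  proof -
    obtain n where n: "n \<in> N" "v = H #> n" using v unfolding cosets by blast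
    then show ?thesis
      using x by (simp add: coset_mult_assoc H.subset sub Int_coset)
  qed
  have closed: "v #> x \<in> rcosets H" if "v \<in> rcosets H" "x \<in> N" for v x
    using that unfolding cosets by (auto simp: coset_mult_assoc H.subset)
  have inj: "inj_on ?f (rcosets H)"
  proof (rule inj_onI)
    fix u v assume u: "u \<in> rcosets H" and v: "v \<in> rcosets H" and eq: "u \<inter> N = v \<inter> N"
    obtain n where n: "n \<in> N" "u = H #> n" using u unfolding cosets by blast
    \<comment> \<open>Each coset meets \<open>N\<close>, so equal traces on \<open>N\<close> give a
      common element, and distinct cosets are disjoint.\<close>
    then have "n \<in> u \<inter> N" using rcos_self[OF _ H] by simp
    then have "u \<inter> v \<noteq> {}" using eq by auto
    then show "u = v" using rcos_disjoint[OF H] u v by (auto simp: pairwise_def disjnt_def)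
  qed
  have A: "{u, v} \<in> {{w, w #> a} | w. w \<in> rcosets H} \<longleftrightarrow>
      {?f u, ?f v} \<in> {{w, w #> a} | w. w \<in> ?f ` (rcosets H)}"
    if uv: "u \<in> rcosets H" "v \<in> rcosets H" for u v
  proof -
    \<comment> \<open>An undirected edge is compared as a whole set: an injective map has injective
      images on subsets of its domain, and \<open>closed\<close> keeps \<open>w #> a\<close> in that
      domain.\<close>
    have "{u, v} = {w, w #> a} \<longleftrightarrow> {?f u, ?f v} = {?f w, ?f w #> a}" if w: "w \<in> rcosets H" for w
      using inj_on_image_eq_iff[OF inj, of "{u, v}" "{w, w #> a}"] uv w closed[OF w a] f_mult[OF w a]
      by simp
    then show ?thesis
      \<comment> \<open>Both edge sets become images over the same index set
        \<open>rcosets H\<close>; the congruence rule then supplies \<open>w \<in> rcosets H\<close>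
        to the equivalence for a single \<open>w\<close>.\<close>
      by (simp only: setcompr_eq_image Collect_mem_eq image_image) (simp only: image_iff cong: bex_cong)
  qed
  have B: "(u, v) \<in> {(w, w #> b) | w. w \<in> rcosets H} \<longleftrightarrow>
      (?f u, ?f v) \<in> {(w, w #> b) | w. w \<in> ?f ` (rcosets H)}"
    if uv: "u \<in> rcosets H" "v \<in> rcosets H" for u v
  proof -
    have "(u, v) = (w, w #> b) \<longleftrightarrow> (?f u, ?f v) = (?f w, ?f w #> b)" if w: "w \<in> rcosets H" for w
      using inj_on_eq_iff[OF inj uv(1) w] inj_on_eq_iff[OF inj uv(2) closed[OF w b]] f_mult[OF w b]
      by simp
    then show ?thesis
      by (simp only: setcompr_eq_image Collect_mem_eq image_image) (simp only: image_iff cong: bex_cong)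
  qed
  show ?thesis
    unfolding AB_isomorphic_def coset_graph_def AB_graph.simps cosets' rcos_eq
    using A B inj_on_imp_bij_betw[OF inj] by (intro exI[of _ ?f] conjI ballI)
qed

lemma group_GL2Z: "group GL2Z"
proof (rule groupI)
  fix x y z :: "int^2^2"
  show "x \<otimes>\<^bsub>GL2Z\<^esub> y \<in> carrier GL2Z" if "x \<in> carrier GL2Z" "y \<in> carrier GL2Z"
    using that by (simp add: GL2Z_def invertible_mult)
  show "\<exists>y\<in>carrier GL2Z. y \<otimes>\<^bsub>GL2Z\<^esub> x = \<one>\<^bsub>GL2Z\<^esub>" if "x \<in> carrier GL2Z"
    using that by (auto simp: GL2Z_def invertible_def)
qed (auto simp: GL2Z_def matrix_mul_assoc invertible_def)

lemma neg_matrix_mult: "(- M) ** N = - (M ** N)" "M ** (- N) = - (M ** N)"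
  for M N :: "'a::ring_1^'n^'n"
  by (simp_all add: vec_eq_iff matrix_matrix_mult_def sum_negf)

lemma pm_eq: "pm M = {M, - M}"
  by (auto simp: pm_def pm_id_def r_coset_def GL2Z_def neg_matrix_mult)

text \<open>The scalar matrices 1 and -1 commute with every matrix, so left and right cosets agree,
  and each is its own inverse.\<close>

lemma normal_pm_id: "pm_id \<lhd> GL2Z"
proof -
  interpret group GL2Z by (rule group_GL2Z)
  have neg_one: "- mat 1 ** - mat 1 = (mat 1 :: int^2^2)" by (simp add: neg_matrix_mult)
  then have inv: "invertible (- mat 1 :: int^2^2)" unfolding invertible_def by blast
  have one: "invertible (mat 1 :: int^2^2)" unfolding invertible_def by auto
  have sub: "subgroup pm_id GL2Z"
  proof (rule subgroupI)
    show "pm_id \<subseteq> carrier GL2Z" using inv one by (auto simp: GL2Z_def pm_id_def)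
    have "inv\<^bsub>GL2Z\<^esub> (- mat 1) = - mat 1"
      by (rule inv_equality) (use inv neg_one in \<open>auto simp: GL2Z_def\<close>)
    moreover have "inv\<^bsub>GL2Z\<^esub> (mat 1) = mat 1"
      using inv_one by (simp add: GL2Z_def)
    ultimately show "inv\<^bsub>GL2Z\<^esub> x \<in> pm_id" if "x \<in> pm_id" for x
      using that by (auto simp: pm_id_def)
  qed (auto simp: pm_id_def GL2Z_def neg_matrix_mult)
  show ?thesis
    unfolding normal_def normal_axioms_def
    using sub is_group by (auto simp: r_coset_def l_coset_def pm_id_def GL2Z_def neg_matrix_mult)
qed

lemma group_PGL2Z: "group PGL2Z"
  unfolding PGL2Z_def by (rule normal.factorgroup_is_group[OF normal_pm_id])

lemma carrier_PGL2Z: "carrier PGL2Z = pm ` carrier GL2Z"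
  by (auto simp: PGL2Z_def FactGroup_def RCOSETS_def pm_def)

lemma one_PGL2Z: "\<one>\<^bsub>PGL2Z\<^esub> = pm (mat 1)"
  by (simp add: PGL2Z_def FactGroup_def pm_eq pm_id_def)

lemma pm_mult:
  "\<lbrakk>M \<in> carrier GL2Z; N \<in> carrier GL2Z\<rbrakk> \<Longrightarrow> pm M \<otimes>\<^bsub>PGL2Z\<^esub> pm N = pm (M ** N)"
  using normal.rcos_sum[OF normal_pm_id, of M N]
  by (simp add: PGL2Z_def FactGroup_def pm_def) (simp add: GL2Z_def)

text \<open>The determinant of an invertible integer matrix is a unit of the integers.\<close>

lemma det_GL2Z:
  assumes "M \<in> carrier GL2Z"
  shows "det M = 1 \<or> det M = - 1"
proof -
  obtain N where "M ** N = mat 1" using assms by (auto simp: GL2Z_def invertible_def)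
  then have "det M * det N = 1" using det_mul[of M N] by simp
  then show ?thesis using zmult_eq_1_iff by blast
qed

text \<open>In even dimension \<open>M\<close> and \<open>- M\<close> have the same determinant, so
  the determinant is well defined on classes and any representative decides membership.\<close>

lemma pm_in_PSL2Z_set_iff:
  assumes "M \<in> carrier GL2Z"
  shows "pm M \<in> PSL2Z_set \<longleftrightarrow> det M = 1"
proof -
  have "det (- N) = det N" for N :: "int^2^2" by (simp add: det_2)
  then show ?thesis using assms by (auto simp: PSL2Z_set_def pm_eq doubleton_eq_iff)
qed

lemma inv_pm:
  assumes "M \<in> carrier GL2Z"
  obtains N where "N \<in> carrier GL2Z" "inv\<^bsub>PGL2Z\<^esub> pm M = pm N" "det N = det M"
proof -
  interpret group PGL2Z by (rule group_PGL2Z)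
  obtain N where N: "M ** N = mat 1" "N ** M = mat 1"
    using assms by (auto simp: GL2Z_def invertible_def)
  then have NG: "N \<in> carrier GL2Z" by (auto simp: GL2Z_def invertible_def)
  have "inv\<^bsub>PGL2Z\<^esub> pm M = pm N"
    by (rule inv_equality) (use N NG assms in \<open>simp_all add: pm_mult one_PGL2Z carrier_PGL2Z\<close>)
  \<comment> \<open>The two determinants have product 1, and both 1 and -1 are their own
    inverses.\<close>
  moreover have "det N = det M"
    using det_mul[of M N] N det_GL2Z[OF assms] by auto
  ultimately show ?thesis using NG that by blast
qed

lemma GL2Z_mult_closed:
  "\<lbrakk>M \<in> carrier GL2Z; N \<in> carrier GL2Z\<rbrakk> \<Longrightarrow> M ** N \<in> carrier GL2Z"
  by (simp add: GL2Z_def invertible_mult)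

lemma subgroup_PSL2Z_set: "subgroup PSL2Z_set PGL2Z"
proof -
  interpret group PGL2Z by (rule group_PGL2Z)
  show ?thesis
  proof (rule subgroupI)
    show "PSL2Z_set \<subseteq> carrier PGL2Z" by (auto simp: PSL2Z_set_def carrier_PGL2Z)
    have "mat 1 \<in> carrier GL2Z" by (auto simp: GL2Z_def invertible_def)
    then have "pm (mat 1) \<in> PSL2Z_set" by (simp add: pm_in_PSL2Z_set_iff)
    then show "PSL2Z_set \<noteq> {}" by blast
  next
    fix x assume "x \<in> PSL2Z_set"
    then obtain M where "M \<in> carrier GL2Z" "x = pm M" "det M = 1" by (auto simp: PSL2Z_set_def)
    then show "inv\<^bsub>PGL2Z\<^esub> x \<in> PSL2Z_set" by (metis inv_pm pm_in_PSL2Z_set_iff)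
  next
    fix x y assume "x \<in> PSL2Z_set" "y \<in> PSL2Z_set"
    then show "x \<otimes>\<^bsub>PGL2Z\<^esub> y \<in> PSL2Z_set"
      by (auto simp: PSL2Z_set_def pm_mult GL2Z_mult_closed det_mul)
  qed
qed

text \<open>This is where index 2 enters: classes outside \<open>PSL2Z_set\<close> have determinant
  -1, so a single such \<open>h\<close> in \<open>H\<close> carries all the others into
  \<open>PSL2Z_set\<close>.\<close>

lemma set_mult_PSL2Z_set:
  assumes H: "subgroup H PGL2Z" and "\<not> H \<subseteq> PSL2Z_set"
  shows "H <#>\<^bsub>PGL2Z\<^esub> PSL2Z_set = carrier PGL2Z"
proof -
  interpret group PGL2Z by (rule group_PGL2Z)
  interpret H: subgroup H PGL2Z by fact
  interpret N: subgroup PSL2Z_set PGL2Z by (rule subgroup_PSL2Z_set)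
  obtain h where h: "h \<in> H" "h \<notin> PSL2Z_set" using assms by blast
  have "\<exists>h'\<in>H. \<exists>n\<in>PSL2Z_set. x = h' \<otimes>\<^bsub>PGL2Z\<^esub> n" if x: "x \<in> carrier PGL2Z" for x
  proof (cases "x \<in> PSL2Z_set")
    case True
    then show ?thesis using H.one_closed x by (metis l_one)
  next
    case False
    obtain M where M: "M \<in> carrier GL2Z" "x = pm M" using x by (auto simp: carrier_PGL2Z)
    obtain K where K: "K \<in> carrier GL2Z" "h = pm K" using h H.subset by (auto simp: carrier_PGL2Z)
    obtain L where L: "L \<in> carrier GL2Z" "inv\<^bsub>PGL2Z\<^esub> h = pm L" "det L = det K"
      using inv_pm K by metis
    have "det M = -1" "det K = -1"
      using False h M K det_GL2Z pm_in_PSL2Z_set_iff by blast+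
    \<comment> \<open>The representative \<open>L ** M\<close> has determinant (-1)(-1) = 1.\<close>
    then have "inv\<^bsub>PGL2Z\<^esub> h \<otimes>\<^bsub>PGL2Z\<^esub> x \<in> PSL2Z_set"
      using L M by (simp add: pm_mult pm_in_PSL2Z_set_iff GL2Z_mult_closed det_mul)
    moreover have "x = h \<otimes>\<^bsub>PGL2Z\<^esub> (inv\<^bsub>PGL2Z\<^esub> h \<otimes>\<^bsub>PGL2Z\<^esub> x)"
      using h x by (simp flip: m_assoc)
    ultimately show ?thesis using h by blast
  qed
  then show ?thesis unfolding set_mult_def by auto
qed

lemma pm_in_PSL2Z_setI:
  assumes "M ** N = mat 1" "N ** M = mat 1" "det M = 1"
  shows "pm M \<in> PSL2Z_set"
  using assms by (auto simp: PSL2Z_set_def GL2Z_def invertible_def)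

lemma gen_A_in_PSL2Z_set: "gen_A \<in> PSL2Z_set"
  unfolding gen_A_def
  \<comment> \<open>For determinant 1 the inverse is the adjugate; here it is the negative of the
    matrix itself, so \<open>gen_A\<close> is an involution.\<close>
  by (rule pm_in_PSL2Z_setI[where N = "vector [vector [0, 1], vector [-1, 0]]"])
    (simp_all add: vec_eq_iff forall_2 matrix_matrix_mult_def sum_2 mat_def det_2)

lemma gen_B_in_PSL2Z_set: "gen_B \<in> PSL2Z_set"
  unfolding gen_B_def
  \<comment> \<open>The witness is again the adjugate: swap the diagonal entries and negate the
    other two.\<close>
  by (rule pm_in_PSL2Z_setI[where N = "vector [vector [1, 1], vector [-1, 0]]"])
    (simp_all add: vec_eq_iff forall_2 matrix_matrix_mult_def sum_2 mat_def det_2)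

theorem lemma8:
  fixes S_hat :: "(int^2^2) set set"
  assumes "subgroup S_hat PGL2Z"
    and "\<not> S_hat \<subseteq> PSL2Z_set"
  shows "AB_isomorphic (coset_graph PGL2Z S_hat gen_A gen_B)
                       (coset_graph PSL2Z (S_hat \<inter> PSL2Z_set) gen_A gen_B)"
  unfolding PSL2Z_def
  by (rule AB_isomorphic_coset_graph_Int[OF group_PGL2Z assms(1) subgroup_PSL2Z_set
        set_mult_PSL2Z_set[OF assms] gen_A_in_PSL2Z_set gen_B_in_PSL2Z_set])

end
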